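(* Let $d\in\mathbb{N}$, $d\ge 1$. For each coordinate $i\in\{1,\dots,d\}$, let $U^{(i)}\subset C([0,1])$ be a unital subalgebra that is dense in $C([0,1])$ with respect to $\|\cdot\|_\infty$. Define $$\mathcal A=\left\{x\mapsto\sum_{j=1}^r\prod_{i=1}^d a^{(i)}_j(x_i)\;:\;a^{(i)}_j\in U^{(i)},\ r\in\mathbb N\right\}.$$ Then $\mathcal A$ is dense in $C([0,1]^d)$ with respect to the uniform norm $\|\cdot\|_\infty$.
   Context: $C([0,1])$ and $C([0,1]^d)$ denote the algebras of real-valued continuous functions on $[0,1]$ and $[0,1]^d$, with the uniform norm. A unital subalgebra is a linear subspace closed under pointwise multiplication and containing the constant function $1$. For $x\in[0,1]^d$, $x_i$ is its $i$-th coordinate. *)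

theory Defs
  imports "HOL-Analysis.Analysis"
begin

text \<open>
  A function on \<open>K\<close> is represented by its extensional version (\<^const>\<open>undefined\<close> outside \<open>K\<close>),
  as in \<^const>\<open>cfunspace\<close>. For compact \<open>K\<close> the boundedness condition in \<^const>\<open>cfunspace\<close> is
  automatic; for compact nonempty \<open>K\<close> the metric is the one given by the uniform norm. Both are
  shown in the two lemmas that follow.
\<close>

definition C_space :: "'a::topological_space set \<Rightarrow> ('a \<Rightarrow> real) metric"
  where "C_space K = cfunspace (top_of_set K) euclidean_metric"

lemma mspace_C_space:
  assumes "compact K"
  shows "mspace (C_space K) = {f \<in> extensional K. continuous_on K f}"
proof -
  have "Metric_space.mbounded UNIV dist (f ` K)" if "continuous_on K f" for f :: "'a \<Rightarrow> real"
    using compact_imp_bounded[OF compact_continuous_image[OF that assms]]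
    by simp
  then show ?thesis
    by (auto simp: C_space_def)
qed

lemma mdist_C_space:
  assumes "f \<in> mspace (C_space K)" "g \<in> mspace (C_space K)"
  shows "mdist (C_space K) f g = (if K = {} then 0 else SUP x\<in>K. \<bar>f x - g x\<bar>)"
proof -
  have "f \<in> mspace (funspace K euclidean_metric)" "g \<in> mspace (funspace K euclidean_metric)"
    using assms cfunspace_subset_funspace[of "top_of_set K" euclidean_metric]
    by (auto simp: C_space_def)
  then show ?thesis
    by (simp add: C_space_def mdist_cfunspace_eq_mdist_funspace Met_TC.fdist_def dist_real_def)
qed

definition unital_subalgebra :: "'a::topological_space set \<Rightarrow> ('a \<Rightarrow> real) set \<Rightarrow> bool"
  where "unital_subalgebra K U \<longleftrightarrow>
    U \<subseteq> mspace (C_space K) \<and>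
    (\<lambda>x\<in>K. 1) \<in> U \<and>
    (\<forall>f\<in>U. \<forall>g\<in>U. (\<lambda>x\<in>K. f x + g x) \<in> U) \<and>
    (\<forall>c. \<forall>f\<in>U. (\<lambda>x\<in>K. c * f x) \<in> U) \<and>
    (\<forall>f\<in>U. \<forall>g\<in>U. (\<lambda>x\<in>K. f x * g x) \<in> U)"

definition dense_in_C :: "'a::topological_space set \<Rightarrow> ('a \<Rightarrow> real) set \<Rightarrow> bool"
  where "dense_in_C K U \<longleftrightarrow>
    U \<subseteq> mspace (C_space K) \<and>
    mtopology_of (C_space K) closure_of U = mspace (C_space K)"

text \<open>The dimension is \<open>CARD('n)\<close>, hence at least one.\<close>

definition unit_cube :: "(real ^ 'n) set"
  where "unit_cube = {x. \<forall>i. x $ i \<in> {0..1}}"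

definition sums_of_products :: "('n::finite \<Rightarrow> (real \<Rightarrow> real) set) \<Rightarrow> (real ^ 'n \<Rightarrow> real) set"
  where "sums_of_products U =
    {(\<lambda>x\<in>unit_cube. \<Sum>j=1..r. \<Prod>i\<in>UNIV. a j i (x $ i)) | (r::nat) a.
      \<forall>j\<in>{1..r}. \<forall>i. a j i \<in> U i}"

end

theory Submission
  imports Defs
begin

text \<open>
  The set of sums of products is itself a unital subalgebra of the continuous functions on the
  cube. Two distinct points differ in some coordinate \<open>i\<close>, and a dense \<open>U i\<close> separates the two
  values of that coordinate, so Stone--Weierstrass applies.
\<close>

text \<open>Passes from topological closure to the epsilon form shared by Stone--Weierstrass and the
  separation argument. The target \<open>f\<close> ranges over all functions continuous on
  \<open>K\<close>, extensional or not, so that it can be taken to be, say, the identity.\<close>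

lemma dense_in_C_iff:
  fixes K :: "'a::topological_space set"
  assumes "compact K"
  shows "dense_in_C K A \<longleftrightarrow> A \<subseteq> mspace (C_space K) \<and>
    (\<forall>f. continuous_on K f \<longrightarrow> (\<forall>e>0. \<exists>g\<in>A. \<forall>x\<in>K. \<bar>f x - g x\<bar> < e))"
proof (cases "A \<subseteq> mspace (C_space K)")
  case True
  interpret C: Metric_space "mspace (C_space K)" "mdist (C_space K)"
    by simp
  have le: "\<bar>f x - g x\<bar> \<le> mdist (C_space K) f g"
    if "f \<in> mspace (C_space K)" "g \<in> mspace (C_space K)" "x \<in> K" for f g x
  proof -
    \<comment> \<open>A real \<open>SUP\<close> bounds its members only when the set is bounded
      above; compactness of \<open>K\<close> provides this.\<close>
    have "continuous_on K (\<lambda>x. \<bar>f x - g x\<bar>)"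
      using that assms by (auto simp: mspace_C_space intro!: continuous_intros)
    then have "bdd_above ((\<lambda>x. \<bar>f x - g x\<bar>) ` K)"
      using assms by (intro bounded_imp_bdd_above compact_imp_bounded compact_continuous_image)
    then show ?thesis
      using that by (auto simp: mdist_C_space intro: cSUP_upper)
  qed
  \<comment> \<open>Positivity of \<open>e\<close> settles the case of empty \<open>K\<close>, where
    the distance is 0.\<close>
  have ge: "mdist (C_space K) f g \<le> e"
    if "f \<in> mspace (C_space K)" "g \<in> mspace (C_space K)" "\<And>x. x \<in> K \<Longrightarrow> \<bar>f x - g x\<bar> \<le> e" "e > 0" for f g e
    using that by (auto simp: mdist_C_space intro: cSUP_least)
  have "mtopology_of (C_space K) closure_of A = mspace (C_space K) \<longleftrightarrow>
    (\<forall>f\<in>mspace (C_space K). \<forall>e>0. \<exists>g\<in>A. mdist (C_space K) f g \<le> e)"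
    using True unfolding mtopology_of_def C.metric_closure_of_alt
    by (auto simp: set_eq_iff subset_iff)
  also have "\<dots> \<longleftrightarrow> (\<forall>f. continuous_on K f \<longrightarrow> (\<forall>e>0. \<exists>g\<in>A. \<forall>x\<in>K. \<bar>f x - g x\<bar> < e))"
    (is "?L \<longleftrightarrow> ?R")
  proof
    assume L: ?L
    show ?R
    proof (intro allI impI)
      fix f :: "'a \<Rightarrow> real" and e :: real
      assume f: "continuous_on K f" and "e > 0"
      have fK: "restrict f K \<in> mspace (C_space K)"
        using f assms by (simp add: mspace_C_space cong: continuous_on_cong)
      \<comment> \<open>The closure is described with closed balls; halving the radius turns their
        \<open>\<le>\<close> into the strict bound.\<close>
      then obtain g where g: "g \<in> A" "mdist (C_space K) (restrict f K) g \<le> e / 2"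
        using L \<open>e > 0\<close> by (meson half_gt_zero)
      have "\<bar>f x - g x\<bar> < e" if "x \<in> K" for x
        using le[OF fK, of g x] g that True \<open>e > 0\<close> by auto
      with g(1) show "\<exists>g\<in>A. \<forall>x\<in>K. \<bar>f x - g x\<bar> < e"
        by blast
    qed
  next
    assume R: ?R
    show ?L
    proof (intro ballI allI impI)
      fix f and e :: real
      assume f: "f \<in> mspace (C_space K)" and "e > 0"
      then obtain g where "g \<in> A" "\<forall>x\<in>K. \<bar>f x - g x\<bar> < e"
        using R unfolding mspace_C_space[OF assms] by blast
      then show "\<exists>g\<in>A. mdist (C_space K) f g \<le> e"
        using ge[OF f, of g e] True \<open>e > 0\<close> by (auto intro: less_imp_le)
    qed
  qed
  finally show ?thesis
    using True by (simp add: dense_in_C_def)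
qed (simp add: dense_in_C_def)

text \<open>Approximate the identity to within half the distance of the two points: equal values
  \<open>g x = g y\<close> would give \<open>\<bar>x - y\<bar> < \<bar>x - y\<bar>\<close> by the
  triangle inequality.\<close>

lemma dense_in_C_separates:
  fixes K :: "real set"
  assumes "compact K" "dense_in_C K A" "x \<in> K" "y \<in> K" "x \<noteq> y"
  shows "\<exists>f\<in>A. f x \<noteq> f y"
proof -
  have "\<exists>g\<in>A. \<forall>z\<in>K. \<bar>z - g z\<bar> < \<bar>x - y\<bar> / 2"
    using assms by (auto simp: dense_in_C_iff[OF \<open>compact K\<close>] simp del: less_divide_eq_numeral1)
  then obtain g where g: "g \<in> A" "\<And>z. z \<in> K \<Longrightarrow> \<bar>z - g z\<bar> < \<bar>x - y\<bar> / 2"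
    by blast
  from g(2)[of x] g(2)[of y] assms have "g x \<noteq> g y"
    by argo
  with g(1) show ?thesis
    by blast
qed

lemma unital_subalgebra_dense:
  fixes K :: "'a::t2_space set"
  assumes K: "compact K" and A: "unital_subalgebra K A"
    and sep: "\<And>x y. \<lbrakk>x \<in> K; y \<in> K; x \<noteq> y\<rbrakk> \<Longrightarrow> \<exists>f\<in>A. f x \<noteq> f y"
  shows "dense_in_C K A"
proof -
  have sub: "A \<subseteq> mspace (C_space K)"
    and one: "(\<lambda>x\<in>K. 1) \<in> A"
    and add: "\<And>f g. f \<in> A \<Longrightarrow> g \<in> A \<Longrightarrow> (\<lambda>x\<in>K. f x + g x) \<in> A"
    and scale: "\<And>c f. f \<in> A \<Longrightarrow> (\<lambda>x\<in>K. c * f x) \<in> A"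
    and mult: "\<And>f g. f \<in> A \<Longrightarrow> g \<in> A \<Longrightarrow> (\<lambda>x\<in>K. f x * g x) \<in> A"
    using A by (simp_all add: unital_subalgebra_def)
  have ext: "restrict f K = f" if "f \<in> A" for f :: "'a \<Rightarrow> real"
    using that sub K by (auto simp: mspace_C_space extensional_restrict)
  \<comment> \<open>Stone--Weierstrass is stated for rings of total functions under plain pointwise
    operations. Extensional functions need not be closed under these, since values outside
    \<open>K\<close> get added and multiplied too; hence the ring consists of all functions whose
    restriction to \<open>K\<close> lies in \<open>A\<close>.\<close>
  interpret function_ring_on "{f. restrict f K \<in> A}" K
  proof
    show "continuous_on K f" if "f \<in> {f. restrict f K \<in> A}" for f
      using that sub K by (auto simp: mspace_C_space cong: continuous_on_cong)
    show "(\<lambda>x. f x + g x) \<in> {f. restrict f K \<in> A}"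
      if "f \<in> {f. restrict f K \<in> A}" "g \<in> {f. restrict f K \<in> A}" for f g
      using add[of "restrict f K" "restrict g K"] that by (simp cong: restrict_cong)
    show "(\<lambda>x. f x * g x) \<in> {f. restrict f K \<in> A}"
      if "f \<in> {f. restrict f K \<in> A}" "g \<in> {f. restrict f K \<in> A}" for f g
      using mult[of "restrict f K" "restrict g K"] that by (simp cong: restrict_cong)
    show "(\<lambda>_. c) \<in> {f. restrict f K \<in> A}" for c
      using scale[OF one, of c] by (simp cong: restrict_cong)
    show "\<exists>f\<in>{f. restrict f K \<in> A}. f x \<noteq> f y" if "x \<in> K" "y \<in> K" "x \<noteq> y" for x y
      using sep[OF that] ext by (metis mem_Collect_eq)
  qed (fact K)
  have "\<exists>g\<in>A. \<forall>x\<in>K. \<bar>f x - g x\<bar> < e" if fe: "continuous_on K f" "e > 0" for f e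
  proof -
    obtain g where "restrict g K \<in> A" "\<forall>x\<in>K. \<bar>f x - g x\<bar> < e"
      using Stone_Weierstrass_basic[OF fe] by auto
    then show ?thesis
      \<comment> \<open>The error is measured on \<open>K\<close> only, so restricting the
        approximant leaves the bound intact.\<close>
      by (intro bexI[of _ "restrict g K"]) auto
  qed
  then show ?thesis
    using sub K by (simp add: dense_in_C_iff)
qed

lemma compact_unit_cube: "compact (unit_cube :: (real ^ 'n) set)"
proof -
  have "(cbox (\<chi> i. 0) (\<chi> i. 1) :: (real ^ 'n) set) = unit_cube"
    by (auto simp: unit_cube_def mem_box_cart)
  then show ?thesis
    using compact_cbox by metis
qed

text \<open>Enumerating \<open>J\<close> allows any finite index set in place of
  \<open>{1..r}\<close>: a singleton for one product, a disjoint union for a sum, a Cartesian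
  product for a product of two sums.\<close>

lemma sums_of_productsI:
  assumes "finite J" "\<And>j i. j \<in> J \<Longrightarrow> a j i \<in> U i"
    and eq: "\<And>x. x \<in> unit_cube \<Longrightarrow> f x = (\<Sum>j\<in>J. \<Prod>i\<in>UNIV. a j i (x $ i))"
  shows "(\<lambda>x\<in>unit_cube. f x) \<in> sums_of_products U"
proof -
  obtain h where h: "bij_betw h {1..card J} J"
    using \<open>finite J\<close> ex_bij_betw_nat_finite_1 by blast
  have "(\<lambda>x\<in>unit_cube. f x) = (\<lambda>x\<in>unit_cube. \<Sum>j=1..card J. \<Prod>i\<in>UNIV. a (h j) i (x $ i))"
    by (intro restrict_ext, unfold eq) (rule sum.reindex_bij_betw[OF h, symmetric])
  moreover have "\<forall>j\<in>{1..card J}. \<forall>i. a (h j) i \<in> U i"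
    using assms(2) bij_betwE[OF h] by blast
  ultimately show ?thesis
    unfolding sums_of_products_def by (intro CollectI exI[of _ "card J"] exI[of _ "\<lambda>j. a (h j)"] conjI)
qed

lemma sums_of_productsE:
  assumes "f \<in> sums_of_products U"
  obtains r a where "\<And>j i. j \<in> {1..r::nat} \<Longrightarrow> a j i \<in> U i"
    and "f = (\<lambda>x\<in>unit_cube. \<Sum>j=1..r. \<Prod>i\<in>UNIV. a j i (x $ i))"
  using assms unfolding sums_of_products_def by blast

text \<open>Adding two such sums joins their lists of terms. Multiplying them expands by
  distributivity, and a product of two terms is again a term because each \<open>U i\<close> is
  closed under multiplication.\<close>

lemma unital_subalgebra_sums_of_products:
  fixes U :: "'n::finite \<Rightarrow> (real \<Rightarrow> real) set"
  assumes U: "\<And>i. unital_subalgebra {0..1} (U i)"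
  shows "unital_subalgebra unit_cube (sums_of_products U)"
proof -
  let ?Q = "unit_cube :: (real ^ 'n) set"
  have cont: "continuous_on {0..1} f" if "f \<in> U i" for f i
    using that U[of i] by (auto simp: unital_subalgebra_def mspace_C_space)
  have one: "(\<lambda>x\<in>{0..1}. 1) \<in> U i"
    and scale: "f \<in> U i \<Longrightarrow> (\<lambda>x\<in>{0..1}. c * f x) \<in> U i"
    and mult: "f \<in> U i \<Longrightarrow> g \<in> U i \<Longrightarrow> (\<lambda>x\<in>{0..1}. f x * g x) \<in> U i" for c f g i
    using U[of i] by (simp_all add: unital_subalgebra_def)
  have cube: "x $ i \<in> {0..1}" if "x \<in> ?Q" for x i
    using that by (simp add: unit_cube_def)
  have "sums_of_products U \<subseteq> mspace (C_space ?Q)"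
  proof
    fix f assume "f \<in> sums_of_products U"
    then obtain r a where a: "\<And>j i. j \<in> {1..r::nat} \<Longrightarrow> a j i \<in> U i"
      and f: "f = (\<lambda>x\<in>?Q. \<Sum>j=1..r. \<Prod>i\<in>UNIV. a j i (x $ i))"
      by (blast elim: sums_of_productsE)
    \<comment> \<open>Each factor is a coordinate projection, which maps the cube into
      \<open>{0..1}\<close>, followed by a function continuous there.\<close>
    have "continuous_on ?Q (\<lambda>x. a j i (x $ i))" if "j \<in> {1..r}" for j i
      by (rule continuous_on_compose2[OF cont[OF a[OF that]]])
        (use cube in \<open>auto intro!: continuous_intros\<close>)
    then have "continuous_on ?Q (\<lambda>x. \<Sum>j=1..r. \<Prod>i\<in>UNIV. a j i (x $ i))"
      by (intro continuous_on_sum continuous_on_prod) auto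
    then show "f \<in> mspace (C_space ?Q)"
      by (simp add: f mspace_C_space compact_unit_cube cong: continuous_on_cong)
  qed
  moreover have "(\<lambda>x\<in>?Q. 1) \<in> sums_of_products U"
    by (rule sums_of_productsI[where J = "{()}" and a = "\<lambda>_ _. \<lambda>x\<in>{0..1}. 1"])
      (use one cube in auto)
  moreover have "(\<lambda>x\<in>?Q. c * f x) \<in> sums_of_products U" if ff: "f \<in> sums_of_products U" for c f
  proof -
    obtain r a where a: "\<And>j i. j \<in> {1..r::nat} \<Longrightarrow> a j i \<in> U i"
      and f: "f = (\<lambda>x\<in>?Q. \<Sum>j=1..r. \<Prod>i\<in>UNIV. a j i (x $ i))"
      using ff by (blast elim: sums_of_productsE)
    \<comment> \<open>The scalar is absorbed into the factor of one arbitrary coordinate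
      \<open>k\<close>; scaling every factor would produce a power of \<open>c\<close>.\<close>
    fix k :: 'n
    let ?b = "\<lambda>j i. if i = k then \<lambda>x\<in>{0..1}. c * a j i x else a j i"
    show ?thesis
    proof (rule sums_of_productsI[where J = "{1..r}" and a = ?b])
      show "?b j i \<in> U i" if "j \<in> {1..r}" for j i
        using a[OF that] scale by simp
      fix x assume x: "x \<in> ?Q"
      \<comment> \<open>Split off the factor at \<open>k\<close>; as \<open>x $ k\<close> lies in
        \<open>{0..1}\<close>, the restricted function there takes its intended value.\<close>
      have "(\<Prod>i\<in>UNIV. ?b j i (x $ i)) = c * (\<Prod>i\<in>UNIV. a j i (x $ i))" for j
        using cube[OF x, of k] by (simp add: prod.remove[of UNIV k])
      then show "c * f x = (\<Sum>j\<in>{1..r}. \<Prod>i\<in>UNIV. ?b j i (x $ i))"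
        using x by (simp add: f sum_distrib_left)
    qed simp
  qed
  moreover have "(\<lambda>x\<in>?Q. f x + g x) \<in> sums_of_products U \<and> (\<lambda>x\<in>?Q. f x * g x) \<in> sums_of_products U"
    if ff: "f \<in> sums_of_products U" and gg: "g \<in> sums_of_products U" for f g
  proof
    obtain r a where a: "\<And>j i. j \<in> {1..r::nat} \<Longrightarrow> a j i \<in> U i"
      and f: "f = (\<lambda>x\<in>?Q. \<Sum>j=1..r. \<Prod>i\<in>UNIV. a j i (x $ i))"
      using ff by (blast elim: sums_of_productsE)
    obtain s b where b: "\<And>j i. j \<in> {1..s::nat} \<Longrightarrow> b j i \<in> U i"
      and g: "g = (\<lambda>x\<in>?Q. \<Sum>j=1..s. \<Prod>i\<in>UNIV. b j i (x $ i))"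
      using gg by (blast elim: sums_of_productsE)
    show "(\<lambda>x\<in>?Q. f x + g x) \<in> sums_of_products U"
      by (rule sums_of_productsI[where J = "{1..r} <+> {1..s}" and a = "case_sum a b"])
        (use a b in \<open>auto simp: f g sum.Plus\<close>)
    \<comment> \<open>The term indexed by a pair is the product of the two terms, multiplied
      coordinate by coordinate.\<close>
    let ?c = "\<lambda>p i. \<lambda>x\<in>{0..1}. a (fst p) i x * b (snd p) i x"
    show "(\<lambda>x\<in>?Q. f x * g x) \<in> sums_of_products U"
    proof (rule sums_of_productsI[where J = "{1..r} \<times> {1..s}" and a = ?c])
      show "?c p i \<in> U i" if "p \<in> {1..r} \<times> {1..s}" for p i
        using that by (intro mult a b) auto
      show "f x * g x = (\<Sum>p\<in>{1..r} \<times> {1..s}. \<Prod>i\<in>UNIV. ?c p i (x $ i))" if "x \<in> ?Q" for x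
        using that cube[OF that]
        by (simp add: f g sum_product prod.distrib sum.cartesian_product split_beta)
    qed simp
  qed
  ultimately show ?thesis
    unfolding unital_subalgebra_def by blast
qed

text \<open>A single product with factor 1 at every coordinate other than \<open>k\<close>. It lifts
  a function separating two \<open>k\<close>-th coordinates to one separating the points of the
  cube.\<close>

lemma sums_of_products_coordinate:
  fixes U :: "'n::finite \<Rightarrow> (real \<Rightarrow> real) set"
  assumes one: "\<And>i. (\<lambda>x\<in>{0..1}. 1) \<in> U i" and f: "f \<in> U k"
  shows "(\<lambda>x\<in>unit_cube. f (x $ k)) \<in> sums_of_products U"
proof (rule sums_of_productsI[where J = "{()}" and a = "\<lambda>_ i. if i = k then f else (\<lambda>x\<in>{0..1}. 1)"])
  fix x :: "real ^ 'n"
  assume "x \<in> unit_cube"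
  then show "f (x $ k) = (\<Sum>j\<in>{()}. \<Prod>i\<in>UNIV. (if i = k then f else (\<lambda>x\<in>{0..1}. 1)) (x $ i))"
    by (simp add: unit_cube_def prod.remove[of UNIV k])
qed (use assms in auto)

theorem theorem1:
  fixes U :: "'n::finite \<Rightarrow> (real \<Rightarrow> real) set"
  assumes "\<And>i. unital_subalgebra {0..1} (U i)"
    and "\<And>i. dense_in_C {0..1} (U i)"
  shows "dense_in_C (unit_cube :: (real ^ 'n) set) (sums_of_products U)"
proof (rule unital_subalgebra_dense[OF compact_unit_cube])
  show "unital_subalgebra unit_cube (sums_of_products U)"
    by (rule unital_subalgebra_sums_of_products) fact
  fix x y :: "real ^ 'n"
  assume xy: "x \<in> unit_cube" "y \<in> unit_cube" "x \<noteq> y"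
  then obtain k where "x $ k \<noteq> y $ k"
    by (auto simp: vec_eq_iff)
  \<comment> \<open>Both \<open>k\<close>-th coordinates lie in \<open>{0..1}\<close>, so the
    density of \<open>U k\<close> separates them.\<close>
  then obtain f where f: "f \<in> U k" "f (x $ k) \<noteq> f (y $ k)"
    using dense_in_C_separates[OF _ assms(2)[of k], of "x $ k" "y $ k"] xy
    by (auto simp: unit_cube_def)
  have "(\<lambda>x\<in>unit_cube. f (x $ k)) \<in> sums_of_products U"
    by (rule sums_of_products_coordinate) (use assms(1) f in \<open>auto simp: unital_subalgebra_def\<close>)
  then show "\<exists>f\<in>sums_of_products U. f x \<noteq> f y"
    using f xy by (intro bexI[of _ "\<lambda>x\<in>unit_cube. f (x $ k)"]) auto
qed

end
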